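(* Let $X$ be a separable metric space and let $\mu$ be a Borel probability measure on $X$. If $\mu$ has a strong mode, then all weak modes of $\mu$ are strong modes of $\mu$.
   Context: $B_r(x)$ denotes the closed ball of radius $r$ centred at $x$. For a Borel probability measure $\mu$ on a separable metric space $X$, $\operatorname{supp}(\mu) = \{x \in X : \mu(B_r(x)) > 0 \text{ for all } r > 0\}$ and $M_r = \sup_{x \in X} \mu(B_r(x))$ for $r>0$. Strong mode of $\mu$: a point $x^\star \in \operatorname{supp}(\mu)$ with $\lim_{r \to 0} \mu(B_r(x^\star))/M_r = 1$. Weak mode of $\mu$: a point $x^\star \in \operatorname{supp}(\mu)$ such that $\limsup_{r \to 0} \mu(B_r(x))/\mu(B_r(x^\star)) \leq 1$ for all $x \in X$. *)

theory Defs
  imports "HOL-Probability.Probability"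
begin

definition supp :: "'a::metric_space measure \<Rightarrow> 'a set" where
  "supp \<mu> = {x. \<forall>r>0. measure \<mu> (cball x r) > 0}"

text \<open>The supremum is over reals; for a probability measure the family is bounded by 1.\<close>
definition max_ball_mass :: "'a::metric_space measure \<Rightarrow> real \<Rightarrow> real" where
  "max_ball_mass \<mu> r = (SUP x. measure \<mu> (cball x r))"

definition strong_mode :: "'a::metric_space measure \<Rightarrow> 'a \<Rightarrow> bool" where
  "strong_mode \<mu> x \<longleftrightarrow> x \<in> supp \<mu> \<and>
     ((\<lambda>r. measure \<mu> (cball x r) / max_ball_mass \<mu> r) \<longlongrightarrow> 1) (at_right 0)"

text \<open>The limit superior is taken in \<^typ>\<open>ereal\<close>, since it may be infinite;
  the denominators are positive because \<open>x\<close> is in the support.\<close>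
definition weak_mode :: "'a::metric_space measure \<Rightarrow> 'a \<Rightarrow> bool" where
  "weak_mode \<mu> x \<longleftrightarrow> x \<in> supp \<mu> \<and>
     (\<forall>y. Limsup (at_right 0)
        (\<lambda>r. ereal (measure \<mu> (cball y r) / measure \<mu> (cball x r))) \<le> 1)"

end

theory Submission
  imports Defs
begin

text \<open>Let \<open>s\<close> be a strong mode and \<open>w\<close> a weak mode, with ball masses
  \<open>a r\<close> and \<open>b r\<close>, and let \<open>M r\<close> be the maximal ball mass.
  Then \<open>b r / M r\<close> is at least roughly \<open>a r / M r\<close> divided by
  \<open>a r / b r\<close>: the former tends to 1, and the latter has limsup at most 1 because
  \<open>w\<close> is a weak mode. Hence the liminf of \<open>b r / M r\<close> is at least 1, while
  \<open>b r \<le> M r\<close> caps the ratio at 1.\<close>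

lemma measure_cball_le_max_ball_mass:
  assumes "prob_space \<mu>"
  shows "measure \<mu> (cball x r) \<le> max_ball_mass \<mu> r"
proof -
  interpret prob_space \<mu> by fact
  show ?thesis
    unfolding max_ball_mass_def
    \<comment> \<open>A real \<open>SUP\<close> is an upper bound only for a family bounded above;
      total mass 1 supplies the bound.\<close>
    by (intro cSUP_upper bdd_aboveI2[where M = 1]) auto
qed

theorem lemma2p2:
  fixes \<mu> :: "'a::metric_space measure"
  assumes "separable_space (euclidean :: 'a topology)"
    and "prob_space \<mu>"
    and "sets \<mu> = sets borel"
    and "\<exists>x. strong_mode \<mu> x"
  shows "\<forall>x. weak_mode \<mu> x \<longrightarrow> strong_mode \<mu> x"
proof (intro allI impI)
  fix w assume w: "weak_mode \<mu> w"
  obtain s where s: "strong_mode \<mu> s" using assms(4) by blast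
  define a b M where "a = (\<lambda>r. measure \<mu> (cball s r))" and "b = (\<lambda>r. measure \<mu> (cball w r))"
    and "M = max_ball_mass \<mu>"
  have w_supp: "w \<in> supp \<mu>" using w by (simp add: weak_mode_def)
  have b_pos: "b r > 0" if "r > 0" for r
    using w_supp that by (simp add: supp_def b_def)
  have b_le: "b r \<le> M r" for r
    using measure_cball_le_max_ball_mass[OF assms(2)] by (simp add: b_def M_def)
  have lim: "((\<lambda>r. a r / M r) \<longlongrightarrow> 1) (at_right 0)"
    using s by (simp add: strong_mode_def a_def M_def)
  \<comment> \<open>The weak mode is tested against the single competitor \<open>s\<close>. A limsup
    of at most 1 gives eventual bounds only by constants \<open>K\<close> strictly above 1.\<close>
  have "Limsup (at_right 0) (\<lambda>r. ereal (a r / b r)) \<le> 1"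
    using w by (simp add: weak_mode_def a_def b_def)
  then have ratio: "\<forall>\<^sub>F r in at_right 0. a r / b r < K" if "K > 1" for K
    using Limsup_lessD[of "at_right 0" "\<lambda>r. ereal (a r / b r)" "ereal K"] that
    by (simp add: le_less_trans)
  have r_pos: "\<forall>\<^sub>F r in at_right (0::real). r > 0"
    by (rule eventually_at_right_less)
  have "((\<lambda>r. b r / M r) \<longlongrightarrow> 1) (at_right 0)"
  proof (rule order_tendstoI)
    fix y :: real assume "y < 1"
    show "\<forall>\<^sub>F r in at_right 0. y < b r / M r"
    proof (cases "y > 0")
      case True
      \<comment> \<open>The square root splits the loss factor \<open>y\<close> evenly between the
        two estimates: \<open>a r > q * M r\<close> and \<open>b r > q * a r\<close> combine to
        \<open>b r > q * q * M r = y * M r\<close>.\<close>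
      define q where "q = sqrt y"
      have q: "0 < q" "q < 1" "q * q = y" using True \<open>y < 1\<close> by (simp_all add: q_def)
      have "\<forall>\<^sub>F r in at_right 0. q < a r / M r"
        using lim q(2) by (rule order_tendstoD)
      moreover have "\<forall>\<^sub>F r in at_right 0. a r / b r < 1 / q"
        by (rule ratio) (use q in simp)
      ultimately show ?thesis using r_pos
      proof eventually_elim
        case (elim r)
        have M: "M r > 0" using b_pos[OF elim(3)] b_le[of r] by linarith
        have "q * (q * M r) < q * a r" using elim(1) M q(1) by (simp add: pos_less_divide_eq)
        also have "\<dots> < b r" using elim(2) b_pos[OF elim(3)] q(1) by (simp add: field_simps)
        finally show ?case using M q(3) by (simp add: pos_less_divide_eq mult.assoc[symmetric])
      qed
    next
      \<comment> \<open>For \<open>y \<le> 0\<close> there is no positive root to split, but the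
        ratio is positive since \<open>w\<close> lies in the support.\<close>
      case False
      show ?thesis using r_pos
      proof eventually_elim
        case (elim r)
        have "b r / M r > 0" using b_pos[OF elim] b_le[of r] by simp
        then show ?case using False by linarith
      qed
    qed
  next
    fix y :: real assume "1 < y"
    show "\<forall>\<^sub>F r in at_right 0. b r / M r < y" using r_pos
    proof eventually_elim
      case (elim r)
      have "b r / M r \<le> 1" using b_pos[OF elim] b_le[of r] by simp
      then show ?case using \<open>1 < y\<close> by linarith
    qed
  qed
  then show "strong_mode \<mu> w" using w_supp by (simp add: strong_mode_def b_def M_def)
qed

end
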